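(* Let $(X,\wp)$ be a consistency space in which every element has a negation, and let $x,y,z\in X$. If $x\to y$ and $y\to z$, then $x\to z$.
   Context: A consistency space $(X,\wp)$ consists of a nonempty set $X$ and a nonempty collection $\wp$ of subsets of $X$ such that (1) $X\notin\wp$, and (2) if $A\in\wp$ and $B\subseteq A$, then $B\in\wp$. For $A,B\subseteq X$, write $A\sim B$ if for every $C\subseteq X$, $A\cup C\in\wp$ if and only if $B\cup C\in\wp$. A negation of $x\in X$ is any element $\bar{x}\in X$ satisfying: (1) $\{x,\bar{x}\}\notin\wp$; (2) for all $z\in X$, if $\{x,z\}\notin\wp$ then $\{\bar{x},z\}\sim\{z\}$; (3) for all $z\in X$, if $\{\bar{x},z\}\notin\wp$ then $\{x,z\}\sim\{z\}$. For each $x\in X$, $\bar{x}$ denotes an (arbitrary but fixed) negation of $x$. For $x,y\in X$, write $x\to y$ if and only if $\{x,\bar{y}\}\notin\wp$. *)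

theory Defs
  imports Main
begin

definition consistency_space :: "'a set \<Rightarrow> 'a set set \<Rightarrow> bool" where
  "consistency_space X P \<longleftrightarrow>
     X \<noteq> {} \<and> P \<noteq> {} \<and> P \<subseteq> Pow X \<and> X \<notin> P \<and>
     (\<forall>A B. A \<in> P \<longrightarrow> B \<subseteq> A \<longrightarrow> B \<in> P)"

definition cons_equiv :: "'a set \<Rightarrow> 'a set set \<Rightarrow> 'a set \<Rightarrow> 'a set \<Rightarrow> bool" where
  "cons_equiv X P A B \<longleftrightarrow> (\<forall>C. C \<subseteq> X \<longrightarrow> (A \<union> C \<in> P \<longleftrightarrow> B \<union> C \<in> P))"

text \<open>Negations need not be unique, so being a negation of \<open>x\<close> is a relation between
  \<open>x\<close> and \<open>x'\<close>.\<close>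

definition is_negation :: "'a set \<Rightarrow> 'a set set \<Rightarrow> 'a \<Rightarrow> 'a \<Rightarrow> bool" where
  "is_negation X P x x' \<longleftrightarrow>
     x' \<in> X \<and> {x, x'} \<notin> P \<and>
     (\<forall>z\<in>X. {x, z} \<notin> P \<longrightarrow> cons_equiv X P {x', z} {z}) \<and>
     (\<forall>z\<in>X. {x', z} \<notin> P \<longrightarrow> cons_equiv X P {x, z} {z})"

text \<open>The function \<open>neg\<close> stands for the fixed choice of a negation for each point of
  \<open>X\<close>.\<close>

definition cons_implies :: "'a set set \<Rightarrow> ('a \<Rightarrow> 'a) \<Rightarrow> 'a \<Rightarrow> 'a \<Rightarrow> bool" where
  "cons_implies P neg x y \<longleftrightarrow> {x, neg y} \<notin> P"

end

theory Submission
  imports Defs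
begin

text \<open>If \<open>x \<rightarrow> y\<close>, then \<open>x\<close> conflicts with the negation of \<open>y\<close>, so adjoining \<open>y\<close> to any set
  that contains \<open>x\<close> does not change whether it is consistent. Apply this to \<open>x\<close> together
  with the negation of \<open>z\<close>: adjoining \<open>y\<close> makes this pair inconsistent because \<open>y \<rightarrow> z\<close>,
  so the pair was inconsistent already.\<close>

theorem proposition10:
  fixes X :: "'a set" and P :: "'a set set" and neg :: "'a \<Rightarrow> 'a" and x y z :: 'a
  assumes "consistency_space X P"
    and "\<forall>u\<in>X. is_negation X P u (neg u)"
    and "x \<in> X" and "y \<in> X" and "z \<in> X"
    and "cons_implies P neg x y" and "cons_implies P neg y z"
  shows "cons_implies P neg x z"
proof -
  have "neg z \<in> X"
    using assms(2,5) by (simp add: is_negation_def)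
  have "{neg y, x} \<notin> P"
    using assms(6) by (simp add: cons_implies_def insert_commute)
  then have "cons_equiv X P {y, x} {x}"
    using assms(2,3,4) by (simp add: is_negation_def)
  then have absorb: "{y, x} \<union> {neg z} \<in> P \<longleftrightarrow> {x} \<union> {neg z} \<in> P"
    using \<open>neg z \<in> X\<close> unfolding cons_equiv_def by blast
  have "{y, neg z} \<notin> P"
    using assms(7) by (simp add: cons_implies_def)
  moreover have "{y, neg z} \<subseteq> {y, x} \<union> {neg z}"
    by blast
  ultimately have "{y, x} \<union> {neg z} \<notin> P"
    using assms(1) unfolding consistency_space_def by blast
  with absorb show ?thesis
    by (simp add: cons_implies_def insert_commute)
qed

end
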